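(* Let $n,k$ be nonnegative integers and $s>0$. Then the modular $s$-Stirling number of the first kind ${n+1\brack k+1}^{(s)}$ equals the number of set partitions $\pi$ of $[n(s+1)-k]$ into exactly $n$ blocks such that the vector $d(\pi)=(d_1,\dots,d_n)$ satisfies $d_i\le s$ for every $1\le i\le n$.
   Context: The $s$-elementary symmetric polynomial is $E_m^{(s)}(x_1,\dots,x_n)=\sum x_1^{a_1}\cdots x_n^{a_n}$, the sum over all $n$-tuples of nonnegative integers with $a_1+\cdots+a_n=m$ and each $a_i\le s$. The modular $s$-Stirling numbers of the first kind are defined by ${n+1\brack k+1}^{(s)}=(n!)^{s}E_k^{(s)}\left(1,\tfrac{1}{2},\dots ,\tfrac{1}{n}\right)$. For a set partition $\pi=B_1/\cdots/B_m$ of $[N]$ with blocks ordered so that $m_1<\cdots<m_m$ where $m_i=\min B_i$, define $d(\pi)=(m_2-m_1-1,\,m_3-m_2-1,\,\dots,\,m_m-m_{m-1}-1,\,N-m_m)$. *)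

theory Defs
  imports Complex_Main "HOL-Library.FuncSet" "HOL-Library.Disjoint_Sets"
begin

text \<open>Variables and exponent tuples are indexed by \<open>{1..n}\<close>; the tuples are functions made
  extensional, so that each tuple is counted once.\<close>

definition s_elem_sym :: "nat \<Rightarrow> nat \<Rightarrow> nat \<Rightarrow> (nat \<Rightarrow> 'a::comm_semiring_1) \<Rightarrow> 'a" where
  "s_elem_sym s m n x =
     (\<Sum>a \<in> {a \<in> {1..n} \<rightarrow>\<^sub>E {0..s}. (\<Sum>i = 1..n. a i) = m}. \<Prod>i = 1..n. x i ^ a i)"

text \<open>Only positive upper and lower arguments are meaningful; other values are unspecified.\<close>

fun modular_stirling1 :: "nat \<Rightarrow> nat \<Rightarrow> nat \<Rightarrow> rat" where
  "modular_stirling1 s (Suc n) (Suc k) =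
     fact n ^ s * s_elem_sym s k n (\<lambda>i. 1 / of_nat i)"

text \<open>\<open>N\<close> is an integer because \<open>n(s+1) - k\<close> may be negative. In that case \<open>[N]\<close> does not exist
  and has no set partitions; without the guard, \<open>{1..N} = {}\<close> would contribute the empty
  partition (a difference visible only for partitions into 0 blocks).\<close>

definition set_partitions :: "int \<Rightarrow> int set set set" where
  "set_partitions N = {P. 0 \<le> N \<and> partition_on {1..N} P}"

definition block_minima :: "int set set \<Rightarrow> int list" where
  "block_minima P = sorted_list_of_set (Min ` P)"

text \<open>List positions are 0-based: \<open>d\<^sub>i\<close> is the entry at position \<open>i - 1\<close>.\<close>

definition d_vector :: "int \<Rightarrow> int set set \<Rightarrow> int list" where
  "d_vector N P = (let ms = block_minima P in
     map (\<lambda>i. if Suc i < length ms then ms ! Suc i - ms ! i - 1 else N - ms ! i)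
       [0..<length ms])"

end

theory Submission
  imports Defs
begin

text \<open>
  The partitions of \<open>{1..N}\<close> with block minima \<open>M\<close> are counted by inserting the elements in
  increasing order: an element of \<open>M\<close> opens a block, any other \<open>x\<close> joins one of the
  \<open>card (M \<inter> {..<x})\<close> blocks already open. With gap vector \<open>d\<close> this gives \<open>\<Prod>i. i ^ d\<^sub>i\<close>
  partitions. In the theorem the \<open>d\<^sub>i\<close> sum to \<open>n * s - k\<close>, so the substitution
  \<open>a\<^sub>i = s - d\<^sub>i\<close> turns the count into \<open>n!\<^sup>s\<close> times the sum of \<open>\<Prod>i. (1 / i) ^ a\<^sub>i\<close> over
  exponents \<open>a\<^sub>i \<le> s\<close> of total \<open>k\<close>. The comparison is carried out by recursion on \<open>n\<close>,
  splitting off the last gap and the last exponent.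
\<close>

section \<open>Set partitions with prescribed block minima\<close>

lemma partition_on_finite_block:
  assumes "partition_on A P" "finite A" "p \<in> P"
  shows "finite p" "p \<noteq> {}" "p \<subseteq> A"
proof -
  show "p \<subseteq> A"
    using assms partition_onD1 by blast
  then show "finite p"
    using assms(2) finite_subset by blast
  show "p \<noteq> {}"
    using assms partition_onD3 by blast
qed

text \<open>Blocks with equal minima share that element, while distinct blocks are disjoint. This is
  what makes the number of minima equal to the number of blocks.\<close>

lemma inj_on_Min_partition:
  fixes A :: "'a::linorder set"
  assumes "partition_on A P" "finite A"
  shows "inj_on Min P"
proof (rule inj_onI)
  fix p q assume pq: "p \<in> P" "q \<in> P" "Min p = Min q"
  have "Min p \<in> p" "Min q \<in> q"
    using partition_on_finite_block[OF assms] pq(1,2) by (blast intro: Min_in)+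
  then show "p = q"
    using pq partition_onD2[OF assms(1)] by (metis disjointD disjoint_iff)
qed

lemma Min_image_partition_subset:
  fixes A :: "'a::linorder set"
  assumes "partition_on A P" "finite A"
  shows "Min ` P \<subseteq> A"
  using partition_on_finite_block[OF assms] Min_in by blast

definition partitions_with_minima :: "'a::linorder set \<Rightarrow> 'a set \<Rightarrow> 'a set set set" where
  "partitions_with_minima A M = {P. partition_on A P \<and> Min ` P = M}"

text \<open>A non-minimum below all of \<open>M\<close> contributes the factor 0, in agreement with
  the absence of such partitions, so it is not necessary to require that \<open>M\<close> contains
  the least element of \<open>A\<close>.\<close>

definition minima_weight :: "'a::linorder set \<Rightarrow> 'a set \<Rightarrow> nat" where
  "minima_weight A M = (\<Prod>x\<in>A - M. card (M \<inter> {..<x}))"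

lemma finite_partitions_with_minima:
  "finite A \<Longrightarrow> finite (partitions_with_minima A M)"
  using finitely_many_partition_on[of A]
  by (rule finite_subset[rotated]) (auto simp: partitions_with_minima_def)

text \<open>Since \<open>b\<close> exceeds all of \<open>A\<close>, a block with minimum
  \<open>b\<close> can only be \<open>{b}\<close>, and removing this block is reversible.\<close>

lemma partitions_with_minima_insert_new:
  fixes b :: "'a::linorder"
  assumes "finite A" "\<forall>a\<in>A. a < b" "b \<in> M"
  shows "partitions_with_minima (insert b A) M =
    insert {b} ` partitions_with_minima A (M - {b})"
proof (intro equalityI subsetI)
  fix P assume "P \<in> partitions_with_minima (insert b A) M"
  then have P: "partition_on (insert b A) P" and M: "Min ` P = M"
    by (auto simp: partitions_with_minima_def)
  obtain p where p: "p \<in> P" "Min p = b"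
    using M assms(3) by auto
  have fin: "finite (insert b A)"
    using assms(1) by simp
  note pb = partition_on_finite_block[OF P fin p(1)]
  have "\<forall>x\<in>p. b \<le> x"
    using pb p(2) by auto
  then have "p = {b}"
    using pb assms(2) by (metis insertE linorder_not_less subset_iff subset_singletonD subsetI
        singletonI)
  with p have bP: "{b} \<in> P"
    by simp
  have disj: "b \<notin> q" if "q \<in> P - {{b}}" for q
    using partition_onD2[OF P] bP that by (metis DiffD1 DiffD2 disjointD disjoint_iff singletonI)
  have "b \<notin> A"
    using assms(2) by blast
  then have "partition_on A (P - {{b}})"
    using P bP disj partition_on_insert[of "{b}" "P - {{b}}" "insert b A"]
    by (simp add: insert_absorb disjnt_iff)
  moreover have "Min ` (P - {{b}}) = M - {b}"
    using inj_on_image_set_diff[OF inj_on_Min_partition[OF P fin], of P "{{b}}"] bP M by simp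
  ultimately show "P \<in> insert {b} ` partitions_with_minima A (M - {b})"
    using bP by (auto simp: partitions_with_minima_def intro!: image_eqI[of _ _ "P - {{b}}"])
next
  fix P assume "P \<in> insert {b} ` partitions_with_minima A (M - {b})"
  then obtain Q where Q: "partition_on A Q" "Min ` Q = M - {b}" "P = insert {b} Q"
    by (auto simp: partitions_with_minima_def)
  have "b \<notin> A"
    using assms(2) by blast
  then have "disjnt {b} (\<Union>Q)" "insert b A - {b} = A"
    using partition_onD1[OF Q(1)] by (auto simp: disjnt_iff)
  then have "partition_on (insert b A) P"
    using Q(1) by (simp add: Q(3) partition_on_insert)
  moreover have "Min ` P = M"
    using Q(2) assms(3) by (simp add: Q(3) insert_absorb)
  ultimately show "P \<in> partitions_with_minima (insert b A) M"
    by (simp add: partitions_with_minima_def)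
qed

text \<open>Here \<open>b\<close> is not a minimum, so its block has smaller elements and keeps its
  minimum when \<open>b\<close> is deleted. The pair \<open>(P, p)\<close> records the remaining
  partition and the block that \<open>b\<close> had joined.\<close>

lemma partitions_with_minima_insert_old:
  fixes b :: "'a::linorder"
  assumes "finite A" "\<forall>a\<in>A. a < b" "M \<subseteq> A"
  shows "bij_betw (\<lambda>(P, p). insert (insert b p) (P - {p}))
    (Sigma (partitions_with_minima A M) (\<lambda>P. P)) (partitions_with_minima (insert b A) M)"
    (is "bij_betw ?f ?S ?T")
proof -
  have bA: "b \<notin> A"
    using assms(2) by blast
  have fin: "finite (insert b A)"
    using assms(1) by simp
  have Min_insert: "Min (insert b p) = Min p" if "p \<subseteq> A" "p \<noteq> {}" for p
  proof -
    have "finite p" using that assms(1) finite_subset by blast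
    then have "Min p < b" using that assms(2) Min_in by blast
    then show ?thesis using \<open>finite p\<close> that by simp
  qed
  have "inj_on ?f ?S"
  proof (rule inj_onI, clarsimp)
    fix P p Q q
    assume P: "P \<in> partitions_with_minima A M" "p \<in> P"
      and Q: "Q \<in> partitions_with_minima A M" "q \<in> Q"
      and eq: "insert (insert b p) (P - {p}) = insert (insert b q) (Q - {q})"
    have bP: "b \<notin> r" if "r \<in> P" for r
      using P bA that partition_onD1 by (auto simp: partitions_with_minima_def)
    have bQ: "b \<notin> r" if "r \<in> Q" for r
      using Q bA that partition_onD1 by (auto simp: partitions_with_minima_def)
    \<comment> \<open>The enlarged block is the only one containing \<open>b\<close>, so the two
      enlarged blocks must coincide.\<close>
    have "insert b p \<in> insert (insert b q) (Q - {q})"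
      using eq by blast
    then have "insert b p = insert b q"
      using bQ by blast
    then have pq: "p = q"
      using bP[OF P(2)] bQ[OF Q(2)] by (simp add: insert_ident)
    have "insert b p \<notin> P - {p}" "insert b p \<notin> Q - {q}"
      using bP bQ by blast+
    then have "P - {p} = Q - {q}"
      using eq pq by (simp add: insert_ident)
    then show "P = Q \<and> p = q"
      using pq P(2) Q(2) by (metis insert_Diff)
  qed
  moreover have "?f ` ?S = ?T"
  proof (intro equalityI subsetI)
    fix R assume "R \<in> ?f ` ?S"
    then obtain P p where P: "partition_on A P" "Min ` P = M" "p \<in> P"
      and R: "R = insert (insert b p) (P - {p})"
      by (auto simp: partitions_with_minima_def)
    note pb = partition_on_finite_block[OF P(1) assms(1) P(3)]
    have disj: "disjnt p (\<Union>(P - {p}))"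
      using partition_onD2[OF P(1)] P(3) by (auto simp: disjnt_iff dest: disjointD)
    have "partition_on (A - p) (P - {p})"
      using partition_on_insert[OF disj] P by (simp add: insert_absorb)
    moreover have "insert b A - insert b p = A - p"
      using bA by blast
    moreover have "disjnt (insert b p) (\<Union>(P - {p}))"
      using disj bA partition_onD1[OF P(1)] by (auto simp: disjnt_iff)
    ultimately have "partition_on (insert b A) R"
      unfolding R using pb by (subst partition_on_insert) auto
    moreover have "Min ` R = insert (Min p) (Min ` (P - {p}))"
      unfolding R by (simp only: image_insert Min_insert[OF pb(3,2)])
    then have "Min ` R = M"
      using P by (metis image_insert insert_Diff)
    ultimately show "R \<in> ?T"
      by (simp add: partitions_with_minima_def)
  next
    fix R assume "R \<in> ?T"
    then have R: "partition_on (insert b A) R" "Min ` R = M"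
      by (auto simp: partitions_with_minima_def)
    obtain B where B: "B \<in> R" "b \<in> B"
      using partition_onD1[OF R(1)] by blast
    note Bb = partition_on_finite_block[OF R(1) fin B(1)]
    define p where "p = B - {b}"
    have Bp: "B = insert b p" "b \<notin> p"
      using B by (auto simp: p_def)
    \<comment> \<open>A singleton block \<open>{b}\<close> would put \<open>b\<close> into
      \<open>M\<close>, which lies inside \<open>A\<close>.\<close>
    have "Min {b} = b" by simp
    then have "B \<noteq> {b}"
      using B R(2) bA assms(3) by (metis imageI subsetD)
    then have p: "p \<noteq> {}" "p \<subseteq> A"
      using Bp Bb by auto
    define P where "P = insert p (R - {B})"
    have disj: "disjnt B (\<Union>(R - {B}))"
      using partition_onD2[OF R(1)] B(1) by (auto simp: disjnt_iff dest: disjointD)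
    have "partition_on (insert b A - B) (R - {B})"
      using partition_on_insert[OF disj] R B by (simp add: insert_absorb)
    moreover have "insert b A - B = A - p"
      using Bp bA by blast
    moreover have disj': "disjnt p (\<Union>(R - {B}))"
      using disj Bp by (auto simp: disjnt_iff)
    ultimately have "partition_on A P"
      unfolding P_def using p by (subst partition_on_insert) auto
    moreover have "Min ` P = insert (Min B) (Min ` (R - {B}))"
      unfolding P_def Bp(1) by (simp only: image_insert Min_insert[OF p(2,1)])
    then have "Min ` P = M"
      using R B by (metis image_insert insert_Diff)
    \<comment> \<open>This ensures that removing \<open>p\<close> from \<open>P\<close> gives back
      exactly \<open>R - {B}\<close>.\<close>
    moreover have "p \<notin> R - {B}"
      using disj' p by (auto simp: disjnt_iff)
    then have "R = ?f (P, p)"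
      using B(1) Bp by (auto simp: P_def)
    moreover have "p \<in> P"
      by (simp add: P_def)
    ultimately show "R \<in> ?f ` ?S"
      by (intro image_eqI[of R ?f "(P, p)"]) (simp_all add: partitions_with_minima_def)
  qed
  ultimately show ?thesis
    by (simp add: bij_betw_def)
qed

text \<open>The element \<open>b\<close> has no factor of its own, being a minimum, and lies above
  every other element, so it is never counted among smaller minima.\<close>

lemma minima_weight_insert_new:
  assumes "\<forall>a\<in>A. a < b" "b \<in> M"
  shows "minima_weight (insert b A) M = minima_weight A (M - {b})"
  unfolding minima_weight_def using assms
  by (intro prod.cong arg_cong[where f = card]) (auto dest: less_asym)

lemma minima_weight_insert_old:
  assumes "finite A" "\<forall>a\<in>A. a < b" "M \<subseteq> A"
  shows "minima_weight (insert b A) M = card M * minima_weight A M"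
proof -
  have "b \<notin> A" "insert b A - M = insert b (A - M)" "M \<inter> {..<b} = M"
    using assms by auto
  then show ?thesis
    using assms(1) by (simp add: minima_weight_def)
qed

text \<open>Both sides obey the same recursion when a new largest element is added: a minimum leaves
  the count unchanged, any other element multiplies it by \<open>card M\<close>.\<close>

lemma card_partitions_with_minima:
  assumes "finite A" "M \<subseteq> A"
  shows "card (partitions_with_minima A M) = minima_weight A M"
  using assms
proof (induction A arbitrary: M rule: finite_linorder_max_induct)
  case empty
  then have "partitions_with_minima {} M = {{}}"
    by (auto simp: partitions_with_minima_def partition_on_empty)
  then show ?case
    by (simp add: minima_weight_def)
next
  case (insert b A)
  show ?case
  proof (cases "b \<in> M")
    case True
    have "{b} \<notin> P" if "P \<in> partitions_with_minima A (M - {b})" for P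
      using that insert.hyps(2) by (auto simp: partitions_with_minima_def partition_on_def)
    then have "inj_on (insert {b}) (partitions_with_minima A (M - {b}))"
      by (intro inj_onI) (simp add: insert_ident)
    then have "card (partitions_with_minima (insert b A) M) =
        card (partitions_with_minima A (M - {b}))"
      using partitions_with_minima_insert_new[OF insert.hyps True] by (simp add: card_image)
    also have "\<dots> = minima_weight A (M - {b})"
      using insert.prems by (intro insert.IH) auto
    finally show ?thesis
      by (simp add: minima_weight_insert_new[OF insert.hyps(2) True])
  next
    case False
    then have M: "M \<subseteq> A"
      using insert.prems by blast
    \<comment> \<open>Injectivity of \<open>Min\<close> gives every \<open>P\<close> exactly
      \<open>card M\<close> blocks, so all fibres of the \<open>Sigma\<close> set have the same
      size.\<close>
    have card: "card P = card M" "finite P" if "P \<in> partitions_with_minima A M" for P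
      using that insert.hyps(1)
      by (auto simp: partitions_with_minima_def inj_on_Min_partition card_image
          intro: finite_elements)
    have "card (partitions_with_minima (insert b A) M) =
        card (Sigma (partitions_with_minima A M) (\<lambda>P. P))"
      using partitions_with_minima_insert_old[OF insert.hyps M] by (simp add: bij_betw_same_card)
    also have "\<dots> = (\<Sum>P\<in>partitions_with_minima A M. card M)"
      using card finite_partitions_with_minima[OF insert.hyps(1)]
      by (simp add: card_SigmaI)
    also have "\<dots> = card M * minima_weight A M"
      by (simp add: insert.IH[OF M])
    finally show ?thesis
      by (simp add: minima_weight_insert_old[OF insert.hyps M])
  qed
qed

section \<open>Minima sets with bounded gaps\<close>

text \<open>For \<open>n > 0\<close>, the covering condition says that 1 is a minimum and that every entry
  of the gap vector is at most \<open>s\<close>.\<close>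

definition spaced_minima :: "nat \<Rightarrow> int \<Rightarrow> nat \<Rightarrow> int set set" where
  "spaced_minima s N n = {M. 0 \<le> N \<and> M \<subseteq> {1..N} \<and> card M = n \<and>
     (\<forall>x\<in>{1..N}. \<exists>m\<in>M. m \<le> x \<and> x \<le> m + int s)}"

text \<open>This is the number of partitions to be computed, in a form that admits a recursion on
  \<open>n\<close>. It vanishes for negative \<open>N\<close>, a case which that recursion can
  reach.\<close>

definition spaced_weight :: "nat \<Rightarrow> int \<Rightarrow> nat \<Rightarrow> nat" where
  "spaced_weight s N n = (\<Sum>M\<in>spaced_minima s N n. minima_weight {1..N} M)"

lemma finite_spaced_minima: "finite (spaced_minima s N n)"
  by (rule finite_subset[of _ "Pow {1..N}"]) (auto simp: spaced_minima_def)

text \<open>An empty set covers no point, which excludes positive \<open>N\<close>; negative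
  \<open>N\<close> is excluded by the guard in \<open>spaced_minima\<close>.\<close>

lemma spaced_minima_0: "spaced_minima s N 0 = (if N = 0 then {{}} else {})"
proof -
  have "M \<in> spaced_minima s N 0 \<longleftrightarrow> N = 0 \<and> M = {}" for M
  proof
    assume M: "M \<in> spaced_minima s N 0"
    \<comment> \<open>Infinite sets also have \<open>card\<close> 0, so finiteness is needed to
      conclude that \<open>M\<close> is empty.\<close>
    then have "finite M"
      by (auto simp: spaced_minima_def intro: finite_subset)
    then have "M = {}"
      using M by (simp add: spaced_minima_def)
    then show "N = 0 \<and> M = {}"
      using M by (auto simp: spaced_minima_def)
  qed (simp add: spaced_minima_def)
  then show ?thesis by auto
qed

lemma spaced_weight_0: "spaced_weight s N 0 = (if N = 0 then 1 else 0)"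
  by (simp add: spaced_weight_def spaced_minima_0 minima_weight_def)

text \<open>Here \<open>j\<close> is the last gap and \<open>N - int j\<close> the largest minimum.
  Covering \<open>N\<close> forces j \<le> s, and the other minima form a spaced set for the
  interval below the largest one.\<close>

lemma spaced_minima_Suc:
  "spaced_minima s N (Suc n) =
    (\<Union>j\<in>{0..s}. insert (N - int j) ` spaced_minima s (N - 1 - int j) n)"
proof (intro equalityI subsetI)
  fix M assume M: "M \<in> spaced_minima s N (Suc n)"
  then have sub: "M \<subseteq> {1..N}" and card: "card M = Suc n"
    and cov: "\<And>x. x \<in> {1..N} \<Longrightarrow> \<exists>m\<in>M. m \<le> x \<and> x \<le> m + int s"
    by (auto simp: spaced_minima_def)
  have fin: "finite M" and ne: "M \<noteq> {}"
    using card by (auto intro: card_ge_0_finite)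
  define m where "m = Max M"
  have m: "m \<in> M" "\<And>x. x \<in> M \<Longrightarrow> x \<le> m"
    using fin ne by (auto simp: m_def)
  have mN: "1 \<le> m" "m \<le> N"
    using m sub by auto
  \<comment> \<open>Whichever minimum covers \<open>N\<close> is at most \<open>m\<close>, so
    \<open>m\<close> itself covers \<open>N\<close>.\<close>
  obtain m' where "m' \<in> M" "N \<le> m' + int s"
    using cov[of N] mN by auto
  then have "N \<le> m + int s"
    using m(2) by fastforce
  define j where "j = nat (N - m)"
  have j: "m = N - int j" "j \<le> s"
    using mN \<open>N \<le> m + int s\<close> by (auto simp: j_def)
  have "M - {m} \<in> spaced_minima s (m - 1) n"
    unfolding spaced_minima_def
  proof (intro CollectI conjI ballI)
    show "0 \<le> m - 1" using mN by simp
    show "M - {m} \<subseteq> {1..m - 1}"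
      using sub m by (force simp: subset_iff)
    show "card (M - {m}) = n"
      using card m(1) by simp
    fix x assume x: "x \<in> {1..m - 1}"
    then obtain y where "y \<in> M" "y \<le> x" "x \<le> y + int s"
      using cov[of x] mN by auto
    then show "\<exists>y\<in>M - {m}. y \<le> x \<and> x \<le> y + int s"
      using x by (intro bexI[of _ y]) auto
  qed
  then have "M \<in> insert m ` spaced_minima s (m - 1) n"
    using m(1) by (intro image_eqI[of _ _ "M - {m}"]) auto
  moreover have "m - 1 = N - 1 - int j"
    using j by simp
  ultimately have "M \<in> insert (N - int j) ` spaced_minima s (N - 1 - int j) n"
    by (simp only: j(1))
  then show "M \<in> (\<Union>j\<in>{0..s}. insert (N - int j) ` spaced_minima s (N - 1 - int j) n)"
    using j(2) by (intro UN_I[of j]) auto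
next
  fix M assume "M \<in> (\<Union>j\<in>{0..s}. insert (N - int j) ` spaced_minima s (N - 1 - int j) n)"
  then obtain j L where j: "j \<le> s" and L: "L \<in> spaced_minima s (N - 1 - int j) n"
    and M: "M = insert (N - int j) L"
    by auto
  from L have nn: "0 \<le> N - 1 - int j" and sub: "L \<subseteq> {1..N - 1 - int j}" and card: "card L = n"
    and cov: "\<And>x. x \<in> {1..N - 1 - int j} \<Longrightarrow> \<exists>m\<in>L. m \<le> x \<and> x \<le> m + int s"
    by (auto simp: spaced_minima_def)
  have "finite L"
    using sub finite_subset by blast
  show "M \<in> spaced_minima s N (Suc n)"
    unfolding spaced_minima_def
  proof (intro CollectI conjI ballI)
    show "0 \<le> N" using nn by simp
    show "M \<subseteq> {1..N}"
      using sub nn unfolding M by (auto simp: subset_iff)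
    show "card M = Suc n"
      using card sub \<open>finite L\<close> unfolding M by (subst card_insert_disjoint) auto
    fix x assume x: "x \<in> {1..N}"
    show "\<exists>m\<in>M. m \<le> x \<and> x \<le> m + int s"
    proof (cases "x \<le> N - 1 - int j")
      case True
      then show ?thesis using cov[of x] x unfolding M by auto
    next
      case False
      then show ?thesis using x j unfolding M by auto
    qed
  qed
qed

text \<open>Each of the \<open>j\<close> elements above the last minimum sees all
  \<open>Suc n\<close> minima; the elements below it see only those in \<open>L\<close>.\<close>

lemma minima_weight_last:
  assumes "L \<in> spaced_minima s (N - 1 - int j) n"
  shows "minima_weight {1..N} (insert (N - int j) L) =
    Suc n ^ j * minima_weight {1..N - 1 - int j} L"
proof -
  from assms have nn: "0 \<le> N - 1 - int j" and sub: "L \<subseteq> {1..N - 1 - int j}" and card: "card L = n"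
    by (auto simp: spaced_minima_def)
  have fin: "finite L"
    using sub finite_subset by blast
  let ?M = "insert (N - int j) L"
  let ?A = "{1..N - 1 - int j} - L" and ?B = "{N - int j + 1..N}"
  have split: "{1..N} - ?M = ?A \<union> ?B"
    using sub nn by (auto simp: subset_iff)
  have A: "card (?M \<inter> {..<x}) = card (L \<inter> {..<x})" if "x \<in> ?A" for x
    using that by (intro arg_cong[where f = card]) auto
  have B: "card (?M \<inter> {..<x}) = Suc n" if "x \<in> ?B" for x
  proof -
    have "?M \<inter> {..<x} = ?M"
      using that sub by auto
    moreover have "card ?M = Suc n"
      using card sub fin by (subst card_insert_disjoint) auto
    ultimately show ?thesis by simp
  qed
  have "minima_weight {1..N} ?M =
      (\<Prod>x\<in>?A. card (?M \<inter> {..<x})) * (\<Prod>x\<in>?B. card (?M \<inter> {..<x}))"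
    unfolding minima_weight_def split by (rule prod.union_disjoint) auto
  also have "\<dots> = (\<Prod>x\<in>?A. card (L \<inter> {..<x})) * (\<Prod>x\<in>?B. Suc n)"
    using A B by (intro arg_cong2[where f = "(*)"] prod.cong) blast+
  finally show ?thesis
    by (simp add: minima_weight_def)
qed

lemma spaced_weight_Suc:
  "spaced_weight s N (Suc n) = (\<Sum>j = 0..s. Suc n ^ j * spaced_weight s (N - 1 - int j) n)"
proof -
  let ?S = "\<lambda>j. spaced_minima s (N - 1 - int j) n"
  let ?I = "\<lambda>j. insert (N - int j) ` ?S j"
  have notin: "N - int j \<notin> L" if "L \<in> ?S j" for j L
    using that by (auto simp: spaced_minima_def)
  \<comment> \<open>The largest element determines \<open>j\<close>, so the sets in the union over
    \<open>j\<close> are disjoint.\<close>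
  have Max: "Max M = N - int j" if "M \<in> ?I j" for M j
  proof -
    obtain L where L: "L \<in> ?S j" "M = insert (N - int j) L"
      using \<open>M \<in> ?I j\<close> by blast
    then have "L \<subseteq> {1..N - 1 - int j}"
      by (simp add: spaced_minima_def)
    moreover from this have "finite L"
      using finite_subset by blast
    ultimately show ?thesis
      unfolding L(2) by (intro Max_eqI) auto
  qed
  have "spaced_weight s N (Suc n) = (\<Sum>M\<in>(\<Union>j\<in>{0..s}. ?I j). minima_weight {1..N} M)"
    by (simp add: spaced_weight_def spaced_minima_Suc)
  also have "\<dots> = (\<Sum>j = 0..s. \<Sum>M\<in>?I j. minima_weight {1..N} M)"
  proof (rule sum.UNION_disjoint)
    show "\<forall>i\<in>{0..s}. \<forall>j\<in>{0..s}. i \<noteq> j \<longrightarrow> ?I i \<inter> ?I j = {}"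
    proof (intro ballI impI)
      fix i j :: nat assume "i \<noteq> j"
      have False if "M \<in> ?I i" "M \<in> ?I j" for M
        using Max[OF that(1)] Max[OF that(2)] \<open>i \<noteq> j\<close> by simp
      then show "?I i \<inter> ?I j = {}" by blast
    qed
  qed (simp_all add: finite_spaced_minima)
  also have "\<dots> = (\<Sum>j = 0..s. \<Sum>L\<in>?S j. minima_weight {1..N} (insert (N - int j) L))"
  proof (rule sum.cong[OF refl])
    fix j
    have "inj_on (insert (N - int j)) (?S j)"
      using notin by (intro inj_onI) (simp add: insert_ident)
    then show "(\<Sum>M\<in>?I j. minima_weight {1..N} M) =
        (\<Sum>L\<in>?S j. minima_weight {1..N} (insert (N - int j) L))"
      by (simp add: sum.reindex)
  qed
  also have "\<dots> = (\<Sum>j = 0..s. Suc n ^ j * spaced_weight s (N - 1 - int j) n)"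
    by (simp add: spaced_weight_def sum_distrib_left minima_weight_last)
  finally show ?thesis .
qed

section \<open>Gap vectors\<close>

text \<open>With 1 in \<open>M\<close>, the points of \<open>{1..N}\<close> split into runs, each
  starting at a minimum and ending before the next one. An entry of \<open>d\<close> is the distance
  from a minimum to the end of its run, so bounding it by \<open>s\<close> means that the minimum
  covers the run.\<close>

lemma d_vector_le_iff:
  assumes "finite M" "M \<subseteq> {1..N}" "N \<ge> 1 \<Longrightarrow> 1 \<in> M"
    and d: "\<And>i. i < card M \<Longrightarrow> d ! i =
      (if Suc i < card M then sorted_list_of_set M ! Suc i - sorted_list_of_set M ! i - 1
       else N - sorted_list_of_set M ! i)"
  shows "(\<forall>i<card M. d ! i \<le> int s) \<longleftrightarrow> (\<forall>x\<in>{1..N}. \<exists>m\<in>M. m \<le> x \<and> x \<le> m + int s)"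
proof -
  define ms where "ms = sorted_list_of_set M"
  have ms: "set ms = M" "length ms = card M" "sorted ms" "sorted_wrt (<) ms"
    using assms(1) by (simp_all add: ms_def)
  have mem: "ms ! i \<in> M" if "i < card M" for i
    using ms that nth_mem by metis
  show ?thesis
  proof (intro iffI ballI allI impI)
    fix x assume le: "\<forall>i<card M. d ! i \<le> int s" and x: "x \<in> {1..N}"
    \<comment> \<open>The largest position in \<open>I\<close> belongs to the last minimum not
      exceeding \<open>x\<close>; the minimum 1 shows that \<open>I\<close> is nonempty.\<close>
    define I where "I = {i. i < card M \<and> ms ! i \<le> x}"
    have "1 \<in> set ms"
      using ms assms(3) x by simp
    then obtain i0 where "i0 < card M" "ms ! i0 = 1"
      using ms(2) by (metis in_set_conv_nth)
    then have "I \<noteq> {}" "finite I"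
      using x by (auto simp: I_def)
    define i where "i = Max I"
    have i: "i \<in> I" "\<And>j. j \<in> I \<Longrightarrow> j \<le> i"
      using \<open>I \<noteq> {}\<close> \<open>finite I\<close> by (auto simp: i_def)
    then have iM: "i < card M" "ms ! i \<le> x"
      by (auto simp: I_def)
    have "x \<le> ms ! i + int s"
    proof (cases "Suc i < card M")
      case True
      then have "Suc i \<notin> I"
        using i(2) by fastforce
      then have "x < ms ! Suc i"
        using True by (auto simp: I_def)
      then show ?thesis
        using d[OF iM(1)] True le[rule_format, OF iM(1)] by (simp flip: ms_def)
    next
      case False
      then have "d ! i = N - ms ! i"
        using d[OF iM(1)] by (simp flip: ms_def)
      then show ?thesis
        using le iM(1) x by fastforce
    qed
    then show "\<exists>m\<in>M. m \<le> x \<and> x \<le> m + int s"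
      using iM mem by blast
  next
    fix i assume cov: "\<forall>x\<in>{1..N}. \<exists>m\<in>M. m \<le> x \<and> x \<le> m + int s" and i: "i < card M"
    \<comment> \<open>At the last position the second premise is vacuous, so the same fact serves
      both cases below.\<close>
    have below: "m \<le> ms ! i" if "m \<in> M" "Suc i < card M \<Longrightarrow> m < ms ! Suc i" for m
    proof -
      obtain l where l: "l < card M" "ms ! l = m"
        using \<open>m \<in> M\<close> ms by (metis in_set_conv_nth)
      have "l \<le> i"
      proof (rule ccontr)
        assume "\<not> l \<le> i"
        then have "Suc i \<le> l" by simp
        then have "ms ! Suc i \<le> ms ! l" "Suc i < card M"
          using ms l by (auto intro: sorted_nth_mono)
        then show False using that(2) l by simp
      qed
      then show ?thesis
        using ms l i by (auto intro: sorted_nth_mono)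
    qed
    show "d ! i \<le> int s"
    proof (cases "Suc i < card M")
      case True
      have lt: "ms ! i < ms ! Suc i"
        using ms True by (simp add: sorted_wrt_nth_less)
      \<comment> \<open>The end of the run is its farthest point, so covering it bounds the gap. In
        the last run \<open>N\<close> takes this role.\<close>
      then have "ms ! Suc i - 1 \<in> {1..N}"
        using mem[OF True] mem[OF i] assms(2) by (auto simp: subset_iff)
      then obtain m where "m \<in> M" "m \<le> ms ! Suc i - 1" "ms ! Suc i - 1 \<le> m + int s"
        using cov by blast
      moreover from this have "m \<le> ms ! i"
        by (intro below) auto
      ultimately show ?thesis
        using d[OF i] True by (simp flip: ms_def)
    next
      case False
      have "N \<in> {1..N}"
        using mem[OF i] assms(2) by (auto simp: subset_iff)
      then obtain m where "m \<in> M" "N \<le> m + int s"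
        using cov by blast
      moreover from this have "m \<le> ms ! i"
        using False by (intro below) auto
      ultimately show ?thesis
        using d[OF i] False by (simp flip: ms_def)
    qed
  qed
qed

text \<open>The covering criterion applies to the set of block minima: \<open>Min\<close> is
  injective on the blocks, and the block containing 1 has minimum 1.\<close>

lemma d_vector_partition_le_iff:
  assumes "partition_on {1..N} P" "0 \<le> N"
  shows "card P = n \<and> (\<forall>i\<in>{1..n}. d_vector N P ! (i - 1) \<le> int s) \<longleftrightarrow>
    Min ` P \<in> spaced_minima s N n"
proof -
  let ?M = "Min ` P"
  have fin: "finite {1..N}" by simp
  have sub: "?M \<subseteq> {1..N}"
    by (rule Min_image_partition_subset[OF assms(1) fin])
  then have finM: "finite ?M"
    using finite_subset by blast
  have card: "card ?M = card P"
    by (rule card_image[OF inj_on_Min_partition[OF assms(1) fin]])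
  have one: "1 \<in> ?M" if "N \<ge> 1"
  proof -
    have "1 \<in> \<Union>P"
      using that by (simp flip: partition_onD1[OF assms(1)])
    then obtain p where p: "p \<in> P" "1 \<in> p"
      by blast
    note pb = partition_on_finite_block[OF assms(1) fin p(1)]
    then have "Min p = 1"
      using p by (intro Min_eqI) auto
    then show ?thesis using p by force
  qed
  have len: "length (block_minima P) = card ?M"
    by (simp add: block_minima_def)
  have "(\<forall>i<card ?M. d_vector N P ! i \<le> int s) \<longleftrightarrow>
      (\<forall>x\<in>{1..N}. \<exists>m\<in>?M. m \<le> x \<and> x \<le> m + int s)"
  proof (rule d_vector_le_iff[OF finM sub one])
    fix i assume "i < card ?M"
    then show "d_vector N P ! i =
      (if Suc i < card ?M then sorted_list_of_set ?M ! Suc i - sorted_list_of_set ?M ! i - 1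
       else N - sorted_list_of_set ?M ! i)"
      using len by (simp add: d_vector_def Let_def block_minima_def)
  qed
  \<comment> \<open>Shift from the indices 1 to \<open>n\<close> to list positions starting at
    0.\<close>
  moreover have "(\<forall>i\<in>{1..n}. d_vector N P ! (i - 1) \<le> int s) \<longleftrightarrow>
      (\<forall>i<n. d_vector N P ! i \<le> int s)"
  proof -
    have "{1..n} = Suc ` {..<n}"
      by (simp add: image_Suc_lessThan)
    then show ?thesis by auto
  qed
  ultimately show ?thesis
    using assms(2) sub card by (auto simp: spaced_minima_def)
qed

text \<open>Partitions are grouped by their set of block minima, and each group is counted by
  \<open>minima_weight\<close>.\<close>

lemma card_bounded_gap_partitions:
  "card {P \<in> set_partitions N. card P = n \<and> (\<forall>i\<in>{1..n}. d_vector N P ! (i - 1) \<le> int s)} =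
    spaced_weight s N n"
proof -
  have "{P \<in> set_partitions N. card P = n \<and> (\<forall>i\<in>{1..n}. d_vector N P ! (i - 1) \<le> int s)} =
      {P. 0 \<le> N \<and> partition_on {1..N} P \<and> Min ` P \<in> spaced_minima s N n}"
    using d_vector_partition_le_iff unfolding set_partitions_def by blast
  also have "\<dots> = (\<Union>M\<in>spaced_minima s N n. partitions_with_minima {1..N} M)"
    by (auto simp: partitions_with_minima_def spaced_minima_def)
  also have "card \<dots> = (\<Sum>M\<in>spaced_minima s N n. card (partitions_with_minima {1..N} M))"
    by (rule card_UN_disjoint)
      (auto simp: finite_spaced_minima finite_partitions_with_minima,
        auto simp: partitions_with_minima_def)
  also have "\<dots> = spaced_weight s N n"
    unfolding spaced_weight_def
    by (intro sum.cong card_partitions_with_minima) (auto simp: spaced_minima_def)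
  finally show ?thesis .
qed

section \<open>The \<open>s\<close>-elementary symmetric polynomials\<close>

lemma s_elem_sym_0: "s_elem_sym s m 0 x = (if m = 0 then 1 else 0)"
  by (simp add: s_elem_sym_def)

text \<open>Classify by the exponent \<open>a\<close> of the last variable; the others then have
  total \<open>m - a\<close>. The test a \<le> m is essential, because truncated subtraction would
  otherwise give spurious terms of total 0.\<close>

lemma s_elem_sym_Suc:
  "s_elem_sym s m (Suc n) x =
    (\<Sum>a = 0..s. if a \<le> m then x (Suc n) ^ a * s_elem_sym s (m - a) n x else 0)"
proof -
  let ?E = "{1..n} \<rightarrow>\<^sub>E {0..s}"
  \<comment> \<open>Moving the condition on the total into the summand leaves an index set that
    splits as a product.\<close>
  have ind: "s_elem_sym s m n x =
      (\<Sum>f\<in>{1..n} \<rightarrow>\<^sub>E {0..s}. if (\<Sum>i = 1..n. f i) = m then \<Prod>i = 1..n. x i ^ f i else 0)"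
    for m n
    unfolding s_elem_sym_def by (rule sum.inter_filter) (simp add: finite_PiE)
  have "{1..Suc n} = insert (Suc n) {1..n}"
    by auto
  then have E: "{1..Suc n} \<rightarrow>\<^sub>E {0..s} = (\<lambda>(a, f). f(Suc n := a)) ` ({0..s} \<times> ?E)"
    by (simp only: PiE_insert_eq)
  have inj: "inj_on (\<lambda>(a, f). f(Suc n := a)) ({0..s} \<times> ?E)"
    by (rule inj_combinator) simp
  have upd: "(\<Sum>i = 1..Suc n. (f(Suc n := a)) i) = (\<Sum>i = 1..n. f i) + a"
    "(\<Prod>i = 1..Suc n. x i ^ (f(Suc n := a)) i) = x (Suc n) ^ a * (\<Prod>i = 1..n. x i ^ f i)"
    for f :: "nat \<Rightarrow> nat" and a
  proof -
    have "(\<Sum>i = 1..n. (f(Suc n := a)) i) = (\<Sum>i = 1..n. f i)"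
      by (rule sum.cong) auto
    then show "(\<Sum>i = 1..Suc n. (f(Suc n := a)) i) = (\<Sum>i = 1..n. f i) + a"
      by simp
    have "(\<Prod>i = 1..n. x i ^ (f(Suc n := a)) i) = (\<Prod>i = 1..n. x i ^ f i)"
      by (rule prod.cong) auto
    then show "(\<Prod>i = 1..Suc n. x i ^ (f(Suc n := a)) i) =
        x (Suc n) ^ a * (\<Prod>i = 1..n. x i ^ f i)"
      by (simp add: mult.commute)
  qed
  have "s_elem_sym s m (Suc n) x = (\<Sum>f\<in>{1..Suc n} \<rightarrow>\<^sub>E {0..s}.
      if (\<Sum>i = 1..Suc n. f i) = m then \<Prod>i = 1..Suc n. x i ^ f i else 0)"
    by (rule ind)
  also have "\<dots> = (\<Sum>(a, f)\<in>{0..s} \<times> ?E.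
      if (\<Sum>i = 1..n. f i) + a = m then x (Suc n) ^ a * (\<Prod>i = 1..n. x i ^ f i) else 0)"
    unfolding E sum.reindex[OF inj]
    by (intro sum.cong refl) (simp only: o_def split_beta upd)
  also have "\<dots> = (\<Sum>a = 0..s. \<Sum>f\<in>?E.
      if (\<Sum>i = 1..n. f i) + a = m then x (Suc n) ^ a * (\<Prod>i = 1..n. x i ^ f i) else 0)"
    by (rule sum.cartesian_product[symmetric])
  also have "\<dots> = (\<Sum>a = 0..s. if a \<le> m then x (Suc n) ^ a * s_elem_sym s (m - a) n x else 0)"
  proof (intro sum.cong refl)
    fix a
    show "(\<Sum>f\<in>?E.
        if (\<Sum>i = 1..n. f i) + a = m then x (Suc n) ^ a * (\<Prod>i = 1..n. x i ^ f i) else 0) =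
      (if a \<le> m then x (Suc n) ^ a * s_elem_sym s (m - a) n x else 0)"
    proof (cases "a \<le> m")
      case True
      then have "t + a = m \<longleftrightarrow> t = m - a" for t
        by auto
      then show ?thesis
        using True by (simp add: ind sum_distrib_left if_distrib cong: if_cong)
    next
      case False
      then have "t + a \<noteq> m" for t
        by auto
      then show ?thesis
        using False by simp
    qed
  qed
  finally show ?thesis .
qed

section \<open>Matching the two recursions\<close>

text \<open>The index \<open>k\<close> ranges over the integers because the recursion for the weights
  may step to negative values, where the weights vanish.\<close>

lemma spaced_weight_eq_s_elem_sym:
  "of_nat (spaced_weight s (int n * (int s + 1) - k) n) =
    (if k < 0 then 0 else fact n ^ s * s_elem_sym s (nat k) n (\<lambda>i. 1 / of_nat i) :: rat)"
proof (induction n arbitrary: k)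
  case 0
  then show ?case
    by (simp add: spaced_weight_0 s_elem_sym_0)
next
  case (Suc n)
  let ?c = "of_nat (Suc n) :: rat"
  let ?e = "\<lambda>k. s_elem_sym s k n (\<lambda>i. 1 / of_nat i) :: rat"
  \<comment> \<open>Removing the last minimum and its gap \<open>j\<close> lowers (n+1)(s+1) - k by
    1 + j, which leaves n(s+1) - (k - (s - j)).\<close>
  have "of_nat (spaced_weight s (int (Suc n) * (int s + 1) - k) (Suc n)) =
      (\<Sum>j = 0..s. ?c ^ j *
        of_nat (spaced_weight s (int n * (int s + 1) - (k - (int s - int j))) n))"
    unfolding spaced_weight_Suc of_nat_sum of_nat_mult of_nat_power
    by (intro sum.cong refl arg_cong2[where f = "(*)"] arg_cong[where f = of_nat]
        arg_cong2[where f = "\<lambda>N. spaced_weight s N"])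
      (simp_all add: algebra_simps)
  \<comment> \<open>The last gap \<open>j\<close> becomes the last exponent a = s - j.\<close>
  also have "\<dots> = (\<Sum>a = 0..s. ?c ^ (s - a) *
        of_nat (spaced_weight s (int n * (int s + 1) - (k - int a)) n))"
    by (rule sum.reindex_bij_witness[of _ "\<lambda>a. s - a" "\<lambda>a. s - a"]) auto
  also have "\<dots> = (\<Sum>a = 0..s. ?c ^ (s - a) *
        (if k < int a then 0 else fact n ^ s * ?e (nat (k - int a))))"
    unfolding Suc.IH by simp
  also have "\<dots> = (if k < 0 then 0 else
      fact (Suc n) ^ s * s_elem_sym s (nat k) (Suc n) (\<lambda>i. 1 / of_nat i))"
  proof (cases "k < 0")
    case True
    then show ?thesis by simp
  next
    case False
    \<comment> \<open>Writing \<open>?c ^ (s - a)\<close> as \<open>?c ^ s * (1 / ?c) ^ a\<close>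
      separates the growth of the factorial power from the contribution of the new variable
      \<open>1 / ?c\<close>.\<close>
    have "?c ^ (s - a) * (if k < int a then 0 else fact n ^ s * ?e (nat (k - int a))) =
        fact (Suc n) ^ s * (if a \<le> nat k then (1 / ?c) ^ a * ?e (nat k - a) else 0)"
      if "a \<in> {0..s}" for a
    proof (cases "a \<le> nat k")
      case True
      have "?c ^ s = ?c ^ (s - a) * ?c ^ a"
        using that by (simp flip: power_add)
      moreover have "?c ^ a * (1 / ?c) ^ a = 1"
        by (simp add: power_one_over del: of_nat_Suc)
      ultimately have "?c ^ (s - a) = ?c ^ s * (1 / ?c) ^ a"
        by (simp add: mult.assoc del: of_nat_Suc)
      moreover have "fact (Suc n) ^ s = ?c ^ s * fact n ^ s"
        by (simp add: power_mult_distrib del: of_nat_Suc)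
      moreover have "nat (k - int a) = nat k - a" "\<not> k < int a"
        using True False by auto
      ultimately show ?thesis
        using True by simp
    next
      case nle: False
      then show ?thesis
        using False by auto
    qed
    then show ?thesis
      using False by (simp add: s_elem_sym_Suc sum_distrib_left)
  qed
  finally show ?case .
qed

theorem theorem5p5:
  fixes n k s :: nat
  assumes "s > 0"
  shows "modular_stirling1 s (n + 1) (k + 1) =
    of_nat (card {P \<in> set_partitions (int n * (int s + 1) - int k).
      card P = n \<and>
      (\<forall>i \<in> {1..n}. d_vector (int n * (int s + 1) - int k) P ! (i - 1) \<le> int s)})"
  unfolding card_bounded_gap_partitions spaced_weight_eq_s_elem_sym by simp

end
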